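(* Let $\mathbb F\in\{\mathbb R,\mathbb C\}$, let $\mathcal H\subseteq\mathbb F^M$ be an $m$-dimensional subspace, and let $\Phi=\{\boldsymbol\varphi_1,\dots,\boldsymbol\varphi_N\}\subset\mathcal H$ be a unit-norm tight frame for $\mathcal H$ with $\gamma_\Phi>0$. Suppose $J\subseteq\{1,\dots,N\}$ and $w_i>0$ for $i\in J$ satisfy $$(1-\varepsilon)\|\boldsymbol a\|_2^2\le\sum_{i\in J}w_i|\langle\boldsymbol a,\boldsymbol\varphi_i\rangle|^2\le(1+\varepsilon)\|\boldsymbol a\|_2^2\quad\text{for all }\boldsymbol a\in\mathcal H$$ for some $0\le\varepsilon<1$. Then $$|J|\ge\max\Big\{m,\frac{m\gamma_\Phi N(1-\varepsilon^2)}{m\gamma_\Phi(1-\varepsilon^2)+N\varepsilon^2}\Big\}.$$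
   Context: A family $\Phi=\{\boldsymbol\varphi_1,\dots,\boldsymbol\varphi_N\}\subset\mathcal H$ is a unit-norm tight frame (UNTF) for the $m$-dimensional space $\mathcal H$ if $\|\boldsymbol\varphi_i\|_2=1$ for all $i$ and $\sum_{i=1}^N|\langle\boldsymbol a,\boldsymbol\varphi_i\rangle|^2=\frac Nm\|\boldsymbol a\|_2^2$ for all $\boldsymbol a\in\mathcal H$. Define on $\mathcal H$ the operators $P_i\boldsymbol a=\langle\boldsymbol a,\boldsymbol\varphi_i\rangle\boldsymbol\varphi_i$ and $Q_i=P_i-\frac1m\mathrm{Id}_{\mathcal H}$, and the real symmetric Gram matrix $\boldsymbol G_\Phi=[\operatorname{trace}(Q_iQ_j)]_{i,j=1}^N\in\mathbb R^{N\times N}$. It satisfies $\boldsymbol G_\Phi\boldsymbol 1_N=\boldsymbol 0$, where $\boldsymbol 1_N$ is the all-ones vector. Define $\gamma_\Phi=\lambda_{\min}(\boldsymbol G_\Phi|_{\boldsymbol 1_N^\perp})$, the smallest eigenvalue of $\boldsymbol G_\Phi$ on the orthogonal complement of $\boldsymbol 1_N$ (with $N\ge2$, so that this complement is nonzero). *)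

theory Defs
  imports "HOL-Analysis.Analysis"
begin

(* The scalar field F in {R, C}.  By Frobenius, the only finite-dimensional real field
   extensions are R and C; the multiplicative norm is then the usual absolute value, and
   rc_mult_cnj_scaleR determines the conjugation.  So, up to isomorphism, the instances below are
   the only models of this class.  The real part of x is the library's "inner x 1"
   (see rc_of_real_inner_1). *)
class real_or_complex = real_normed_field + euclidean_space +
  fixes rc_cnj :: "'a \<Rightarrow> 'a"
  assumes rc_cnj_add: "rc_cnj (x + y) = rc_cnj x + rc_cnj y"
    and rc_mult_cnj_scaleR: "x * rc_cnj x = (norm x)\<^sup>2 *\<^sub>R 1"

instantiation real :: real_or_complex
begin
definition rc_cnj_real :: "real \<Rightarrow> real" where "rc_cnj_real x = x"
instance by standard (auto simp: rc_cnj_real_def power2_eq_square)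
end

instantiation complex :: real_or_complex
begin
definition rc_cnj_complex :: "complex \<Rightarrow> complex" where "rc_cnj_complex z = cnj z"
instance
  by standard (simp_all add: rc_cnj_complex_def complex_norm_square[symmetric] scaleR_conv_of_real del: of_real_power)
end

lemma rc_mult_cnj: "(x::'f::real_or_complex) * rc_cnj x = of_real ((norm x)\<^sup>2)"
  by (simp add: rc_mult_cnj_scaleR of_real_def)

lemma rc_of_real_inner_1:
  fixes x :: "'f::real_or_complex"
  shows "of_real (inner x 1) = (x + rc_cnj x) / 2"
proof -
  have c1: "rc_cnj (1::'f) = 1" using rc_mult_cnj[of "1::'f"] by simp
  have "of_real ((norm (x + 1))\<^sup>2) = (x + 1) * (rc_cnj x + 1)"
    using rc_mult_cnj[of "x + 1"] by (simp add: rc_cnj_add c1)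
  also have "\<dots> = of_real ((norm x)\<^sup>2) + x + rc_cnj x + 1"
    using rc_mult_cnj[of x] by (simp add: algebra_simps)
  finally have a: "(of_real ((norm (x + 1))\<^sup>2) :: 'f) = of_real ((norm x)\<^sup>2) + x + rc_cnj x + 1" .
  have "(norm (x + 1))\<^sup>2 = (norm x)\<^sup>2 + 2 * inner x 1 + 1"
    using dot_norm[of x 1] by simp
  hence "(of_real ((norm (x + 1))\<^sup>2) :: 'f) = of_real ((norm x)\<^sup>2) + 2 * of_real (inner x 1) + 1"
    by simp
  with a show ?thesis by (simp add: field_simps)
qed

definition hip :: "'f::real_or_complex^'n \<Rightarrow> 'f^'n \<Rightarrow> 'f" where
  "hip x y = (\<Sum>l\<in>UNIV. x $ l * rc_cnj (y $ l))"

(* The family is indexed by a finite type, so N = CARD('k); the dimension is over F. *)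
definition unit_norm_tight_frame ::
    "('f::real_or_complex^'n) set \<Rightarrow> ('k::finite \<Rightarrow> 'f^'n) \<Rightarrow> bool" where
  "unit_norm_tight_frame H \<phi> \<longleftrightarrow>
     (\<forall>i. \<phi> i \<in> H) \<and> (\<forall>i. norm (\<phi> i) = 1) \<and>
     (\<forall>a\<in>H. (\<Sum>i\<in>UNIV. (norm (hip a (\<phi> i)))\<^sup>2)
        = real CARD('k) / real (vec.dim H) * (norm a)\<^sup>2)"

definition frame_P :: "('k \<Rightarrow> 'f::real_or_complex^'n) \<Rightarrow> 'k \<Rightarrow> 'f^'n \<Rightarrow> 'f^'n" where
  "frame_P \<phi> i a = hip a (\<phi> i) *s \<phi> i"

definition frame_Q ::
    "('f::real_or_complex^'n) set \<Rightarrow> ('k \<Rightarrow> 'f^'n) \<Rightarrow> 'k \<Rightarrow> 'f^'n \<Rightarrow> 'f^'n" where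
  "frame_Q H \<phi> i a = frame_P \<phi> i a - (1 / of_nat (vec.dim H)) *s a"

(* Trace over F of an operator T on the subspace H (not on the ambient space). *)
definition trace_on :: "('f::field^'n) set \<Rightarrow> ('f^'n \<Rightarrow> 'f^'n) \<Rightarrow> 'f" where
  "trace_on H T =
     (let B = (SOME B. B \<subseteq> H \<and> vec.independent B \<and> vec.span B = H)
      in \<Sum>b\<in>B. vec.representation B (T b) b)"

(* The traces are real (of_real_gram_matrix below), so taking real parts only changes the type. *)
definition gram_matrix ::
    "('f::real_or_complex^'n) set \<Rightarrow> ('k::finite \<Rightarrow> 'f^'n) \<Rightarrow> real^'k^'k" where
  "gram_matrix H \<phi> = (\<chi> i j. inner (trace_on H (frame_Q H \<phi> i \<circ> frame_Q H \<phi> j)) 1)"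

definition min_eigenvalue_on :: "(real^'k) set \<Rightarrow> real^'k^'k \<Rightarrow> real" where
  "min_eigenvalue_on V A = Min {c. \<exists>v\<in>V. v \<noteq> 0 \<and> A *v v = c *\<^sub>R v}"

(* Here 1 :: real^'k is the all-ones vector. *)
definition frame_gamma ::
    "('f::real_or_complex^'n) set \<Rightarrow> ('k::finite \<Rightarrow> 'f^'n) \<Rightarrow> real" where
  "frame_gamma H \<phi> = min_eigenvalue_on ({1}\<^sup>\<bottom>) (gram_matrix H \<phi>)"

lemma hip_sum_left: "hip (\<Sum>b\<in>B. c b *s b) y = (\<Sum>b\<in>B. c b * hip b y)"
  unfolding hip_def
  by (simp add: sum_distrib_right sum_distrib_left mult.assoc) (rule sum.swap)

lemma hip_diff_left: "hip (x - z) y = hip x y - hip z y"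
  by (simp add: hip_def sum_subtractf algebra_simps)

lemma hip_scale_left: "hip (c *s x) y = c * hip x y"
  by (simp add: hip_def sum_distrib_left mult.assoc)

lemma rc_cnj_eq: "rc_cnj (x::'f::real_or_complex) = of_real (2 * inner x 1) - x"
  by (simp add: rc_of_real_inner_1 field_simps)

lemma rc_inner_1_1: "inner (1::'f::real_or_complex) 1 = 1"
  by (simp add: dot_square_norm)

lemma rc_cnj_cnj [simp]: "rc_cnj (rc_cnj (x::'f::real_or_complex)) = x"
proof -
  have "inner (rc_cnj x) (1::'f) = inner x 1"
    unfolding rc_cnj_eq[of x] by (simp add: inner_diff_left of_real_def rc_inner_1_1)
  thus ?thesis by (simp add: rc_cnj_eq)
qed

lemma rc_cnj_zero [simp]: "rc_cnj (0::'f::real_or_complex) = 0"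
  by (simp add: rc_cnj_eq)

lemma rc_cnj_sum: "rc_cnj (sum f A :: 'f::real_or_complex) = (\<Sum>x\<in>A. rc_cnj (f x))"
  by (induction A rule: infinite_finite_induct) (auto simp: rc_cnj_add)

lemma rc_cnj_mult: "rc_cnj (x * y :: 'f::real_or_complex) = rc_cnj x * rc_cnj y"
proof (cases "x * y = 0")
  case False
  have "(x * y) * rc_cnj (x * y) = (x * rc_cnj x) * (y * rc_cnj y)"
    by (simp only: rc_mult_cnj) (simp add: norm_mult power_mult_distrib)
  hence "(x * y) * rc_cnj (x * y) = (x * y) * (rc_cnj x * rc_cnj y)" by (simp add: ac_simps)
  thus ?thesis using False by simp
qed auto

lemma hip_commute: "rc_cnj (hip x y) = hip y x"
  by (simp add: hip_def rc_cnj_sum rc_cnj_mult ac_simps)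

lemma hip_self: "hip x x = of_real ((norm x)\<^sup>2)"
  by (simp add: hip_def rc_mult_cnj norm_vec_def L2_set_def sum_nonneg)

(* In particular the traces defining the Gram matrix are real. *)
lemma trace_Q_comp_Q:
  fixes H :: "('f::real_or_complex^'n) set" and \<phi> :: "'k::finite \<Rightarrow> 'f^'n"
  assumes H: "vec.subspace H" and \<phi>: "unit_norm_tight_frame H \<phi>"
  shows "trace_on H (frame_Q H \<phi> i \<circ> frame_Q H \<phi> j)
    = of_real ((norm (hip (\<phi> i) (\<phi> j)))\<^sup>2 - 1 / real (vec.dim H))"
proof -
  let ?m = "vec.dim H" and ?d = "1 / of_nat (vec.dim H) :: 'f"
  define B where "B = (SOME B. B \<subseteq> H \<and> vec.independent B \<and> vec.span B = H)"
  have "\<exists>B. B \<subseteq> H \<and> vec.independent B \<and> vec.span B = H"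
    by (metis H vec.basis_exists vec.span_subspace)
  hence "B \<subseteq> H \<and> vec.independent B \<and> vec.span B = H"
    unfolding B_def by (rule someI_ex)
  hence B: "B \<subseteq> H" "vec.independent B" "vec.span B = H" by auto
  have fin: "finite B" using B(2) by (rule vec.finiteI_independent)
  have card: "card B = ?m" using B by (metis vec.dim_eq_card_independent vec.dim_span)
  have in_H: "\<phi> l \<in> H" and nrm: "norm (\<phi> l) = 1" for l
    using \<phi> by (auto simp: unit_norm_tight_frame_def)
  have "?m \<noteq> 0"
  proof
    assume "?m = 0"
    hence "B = {}" using card fin card_0_eq by metis
    hence "\<phi> i = 0" using B(3) in_H[of i] by auto
    thus False using nrm[of i] by simp
  qed
  let ?r = "\<lambda>l b. vec.representation B (\<phi> l) b"
  have rep: "(\<Sum>b\<in>B. ?r l b * hip b y) = hip (\<phi> l) y" for l y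
    using vec.sum_representation_eq[OF B(2) _ fin subset_refl, of "\<phi> l"] in_H[of l] B(3)
      hip_sum_left[of "?r l" B y] by simp
  have QQ: "(frame_Q H \<phi> i \<circ> frame_Q H \<phi> j) b
      = (hip b (\<phi> j) * hip (\<phi> j) (\<phi> i)) *s \<phi> i + (- ?d * hip b (\<phi> i)) *s \<phi> i
        + (- ?d * hip b (\<phi> j)) *s \<phi> j + (?d * ?d) *s b" for b
    unfolding frame_Q_def frame_P_def comp_def vec_eq_iff
    by (simp add: hip_diff_left hip_scale_left algebra_simps)
  have rep_QQ: "vec.representation B ((frame_Q H \<phi> i \<circ> frame_Q H \<phi> j) b) b
      = hip (\<phi> j) (\<phi> i) * (?r i b * hip b (\<phi> j)) - ?d * (?r i b * hip b (\<phi> i))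
        - ?d * (?r j b * hip b (\<phi> j)) + ?d * ?d" if "b \<in> B" for b
  proof -
    have bH: "b \<in> vec.span B" and i: "\<phi> i \<in> vec.span B" and j: "\<phi> j \<in> vec.span B"
      using that B in_H by auto
    show ?thesis
      unfolding QQ
      using vec.representation_basis[OF B(2) that]
      by (simp only: vec.representation_add[OF B(2)] vec.representation_scale[OF B(2)]
          vec.span_add vec.span_scale bH i j) (simp add: algebra_simps)
  qed
  have "trace_on H (frame_Q H \<phi> i \<circ> frame_Q H \<phi> j)
      = (\<Sum>b\<in>B. vec.representation B ((frame_Q H \<phi> i \<circ> frame_Q H \<phi> j) b) b)"
    by (simp add: trace_on_def Let_def B_def)
  also have "\<dots> = hip (\<phi> j) (\<phi> i) * hip (\<phi> i) (\<phi> j) - ?d * hip (\<phi> i) (\<phi> i)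
      - ?d * hip (\<phi> j) (\<phi> j) + of_nat ?m * (?d * ?d)"
    by (simp only: rep_QQ sum.distrib sum_subtractf rep sum_constant card
        sum_distrib_left[symmetric] cong: sum.cong)
  also have "\<dots> = hip (\<phi> i) (\<phi> j) * rc_cnj (hip (\<phi> i) (\<phi> j)) - ?d"
    using \<open>?m \<noteq> 0\<close> by (simp add: hip_commute hip_self nrm ac_simps)
  finally show ?thesis by (simp add: rc_mult_cnj)
qed

lemma of_real_gram_matrix:
  fixes H :: "('f::real_or_complex^'n) set" and \<phi> :: "'k::finite \<Rightarrow> 'f^'n"
  assumes "vec.subspace H" and "unit_norm_tight_frame H \<phi>"
  shows "of_real (gram_matrix H \<phi> $ i $ j) = trace_on H (frame_Q H \<phi> i \<circ> frame_Q H \<phi> j)"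
  unfolding gram_matrix_def
  by (simp only: vec_lambda_beta trace_Q_comp_Q[OF assms] of_real_inner_1)

end

theory Submission
  imports Defs
begin

text \<open>
  Extend the weights by zero to all indices, and let \<open>S = \<Sum>i. w i P\<^sub>i\<close> be the frame operator on
  \<open>H\<close> and \<open>W = \<Sum>i. w i\<close> its trace. The bounds on the weighted sums say \<open>1 - \<epsilon> \<le> S \<le> 1 + \<epsilon>\<close>. In
  particular \<open>S\<close> is injective on \<open>H\<close>, while its range lies in the span of the at most \<open>|J|\<close> vectors
  indexed by \<open>J\<close>; this gives \<open>|J| \<ge> m\<close> (\<open>dim_le_card_of_lower_bound\<close>).

  For the other bound, the quadratic form of the Gram matrix at \<open>w\<close> is \<open>tr (S\<^sup>2) - W\<^sup>2 / m\<close>, and it is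
  estimated from both sides. From below, split off the component of \<open>w\<close> along the all-ones vector;
  the Rayleigh bound on the rest (\<open>frame_gamma_le\<close>) and the Cauchy--Schwarz inequality
  \<open>\<Sum>i. (w i)\<^sup>2 \<ge> W\<^sup>2 / |J|\<close> give at least \<open>\<gamma> (W\<^sup>2 / |J| - W\<^sup>2 / N)\<close>. From above,
  \<open>S\<^sup>2 \<le> 2 S - (1 - \<epsilon>\<^sup>2)\<close> (\<open>norm_frame_op_sq_le\<close>), and the trace of this inequality, followed by
  \<open>2 a b - b\<^sup>2 \<le> a\<^sup>2\<close>, gives
  \<open>tr (S\<^sup>2) \<le> 2 W - m (1 - \<epsilon>\<^sup>2) \<le> W\<^sup>2 / (m (1 - \<epsilon>\<^sup>2))\<close>. Dividing by \<open>W\<^sup>2\<close> yields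
  \<open>\<gamma> (1 / |J| - 1 / N) \<le> \<epsilon>\<^sup>2 / (m (1 - \<epsilon>\<^sup>2))\<close>, which rearranges to the claim
  (\<open>card_bound_of_gap\<close>).

  No orthonormal basis of \<open>H\<close> is needed to take the trace: the sum of a quadratic form over the
  vectors of a unit-norm tight frame is \<open>N / m\<close> times the trace. The real and complex cases are
  treated together by working with the real inner product, which is the real part of \<open>hip\<close>.
\<close>

section \<open>Positive semidefinite forms and Rayleigh quotients\<close>

lemma psd_Cauchy_Schwarz:
  fixes T :: "'a::real_inner \<Rightarrow> 'a"
  assumes T: "linear T" and V: "subspace V"
    and sym: "\<And>x y. x \<in> V \<Longrightarrow> y \<in> V \<Longrightarrow> inner (T x) y = inner x (T y)"
    and psd: "\<And>x. x \<in> V \<Longrightarrow> 0 \<le> inner (T x) x"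
    and x: "x \<in> V" and y: "y \<in> V"
  shows "(inner (T x) y)\<^sup>2 \<le> inner (T x) x * inner (T y) y"
proof -
  let ?a = "inner (T x) x" and ?b = "inner (T x) y" and ?d = "inner (T y) y"
  have b: "inner (T y) x = ?b"
    using sym[OF x y] by (simp add: inner_commute)
  have q: "0 \<le> s\<^sup>2 * ?a + 2 * s * t * ?b + t\<^sup>2 * ?d" for s t
  proof -
    have "s *\<^sub>R x + t *\<^sub>R y \<in> V"
      using V x y by (simp add: subspace_add subspace_scale)
    from psd[OF this] show ?thesis
      by (simp add: linear_add[OF T] linear_scale[OF T] inner_add_left inner_add_right b
          power2_eq_square algebra_simps)
  qed
  show ?thesis
  proof (cases "?d = 0")
    case True
    have "?b = 0"
    proof (rule ccontr)
      \<comment> \<open>otherwise the form is affine and nonconstant along \<open>x + t y\<close>, so it takes the value \<open>-1\<close>\<close>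
      assume "?b \<noteq> 0"
      then have "?a + 2 * (- (?a + 1) / (2 * ?b)) * ?b = -1"
        by (simp add: field_simps)
      then show False using q[of 1 "- (?a + 1) / (2 * ?b)"] True by simp
    qed
    then show ?thesis using True by simp
  next
    case False
    then have d: "?d > 0" using psd[OF y] by simp
    have "0 \<le> ?d * (?a * ?d - ?b\<^sup>2)"
      using q[of ?d "- ?b"] by (simp add: power2_eq_square algebra_simps)
    then show ?thesis using d by (simp add: zero_le_mult_iff)
  qed
qed

text \<open>A positive semidefinite operator \<open>T\<close> with \<open>T \<le> K\<close> satisfies \<open>T\<^sup>2 \<le> K T\<close>. The proof applies
  the Cauchy--Schwarz inequality of the form of \<open>T\<close> to \<open>x\<close> and \<open>T x\<close>, and so needs no spectral
  theorem.\<close>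

lemma psd_norm_sq_le:
  fixes T :: "'a::real_inner \<Rightarrow> 'a"
  assumes T: "linear T" and V: "subspace V"
    and inv: "\<And>x. x \<in> V \<Longrightarrow> T x \<in> V"
    and sym: "\<And>x y. x \<in> V \<Longrightarrow> y \<in> V \<Longrightarrow> inner (T x) y = inner x (T y)"
    and psd: "\<And>x. x \<in> V \<Longrightarrow> 0 \<le> inner (T x) x"
    and ub: "\<And>x. x \<in> V \<Longrightarrow> inner (T x) x \<le> K * (norm x)\<^sup>2"
    and x: "x \<in> V"
  shows "(norm (T x))\<^sup>2 \<le> K * inner (T x) x"
proof (cases "T x = 0")
  case True
  then show ?thesis by simp
next
  case False
  let ?n = "(norm (T x))\<^sup>2"
  have "?n * ?n \<le> inner (T x) x * inner (T (T x)) (T x)"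
    using psd_Cauchy_Schwarz[OF T V sym psd x inv[OF x]]
    by (simp only: dot_square_norm power2_eq_square)
  also have "\<dots> \<le> inner (T x) x * (K * ?n)"
    by (intro mult_left_mono ub inv x psd)
  finally have "?n * ?n \<le> (K * inner (T x) x) * ?n" by (simp add: ac_simps)
  then show ?thesis by (rule mult_right_le_imp_le) (use False in simp)
qed

text \<open>Eigenvectors of distinct eigenvalues of a symmetric matrix are orthogonal.\<close>

lemma finite_eigenvalues_on:
  fixes A :: "real^'k^'k"
  assumes sym: "transpose A = A"
  shows "finite {c. \<exists>v\<in>V. v \<noteq> 0 \<and> A *v v = c *\<^sub>R v}" (is "finite ?E")
proof -
  define e where "e c = (SOME v. v \<noteq> 0 \<and> A *v v = c *\<^sub>R v)" for c
  have e: "e c \<noteq> 0 \<and> A *v e c = c *\<^sub>R e c" if "c \<in> ?E" for c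
    unfolding e_def by (rule someI_ex) (use that in blast)
  have orth: "inner (e c) (e d) = 0" if c: "c \<in> ?E" and d: "d \<in> ?E" and "c \<noteq> d" for c d
  proof -
    have "inner (A *v e c) (e d) = inner (e c) (A *v e d)"
      using sym by (metis dot_lmul_matrix transpose_matrix_vector)
    then have "c * inner (e c) (e d) = d * inner (e c) (e d)"
      using e[OF c] e[OF d] by simp
    then show ?thesis using \<open>c \<noteq> d\<close> by simp
  qed
  have "inj_on e ?E"
  proof (rule inj_onI)
    fix c d assume cd: "c \<in> ?E" "d \<in> ?E" "e c = e d"
    show "c = d"
    proof (rule ccontr)
      assume "c \<noteq> d"
      then have "inner (e c) (e c) = 0" using orth[of c d] cd by simp
      then show False using e[OF cd(1)] by simp
    qed
  qed
  moreover have "finite (e ` ?E)"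
  proof (rule pairwise_orthogonal_imp_finite)
    show "pairwise orthogonal (e ` ?E)"
      unfolding pairwise_def orthogonal_def using orth by blast
  qed
  ultimately show ?thesis using finite_imageD by blast
qed

text \<open>The Rayleigh bound. A minimiser \<open>u\<close> of the Rayleigh quotient on \<open>V\<close>, with value \<open>c\<close>, is an
  eigenvector: \<open>A - c\<close> is positive semidefinite on \<open>V\<close> and its form vanishes at \<open>u\<close>, so by
  Cauchy--Schwarz \<open>A u - c u\<close> is orthogonal to itself. As there are only finitely many eigenvalues,
  their minimum is a genuine one, and is at most \<open>c\<close>.\<close>

lemma min_eigenvalue_on_le:
  fixes A :: "real^'k^'k"
  assumes sym: "transpose A = A" and V: "subspace V"
    and inv: "\<And>x. x \<in> V \<Longrightarrow> A *v x \<in> V"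
    and v: "v \<in> V"
  shows "min_eigenvalue_on V A * (norm v)\<^sup>2 \<le> inner (A *v v) v"
proof (cases "v = 0")
  case True
  then show ?thesis by simp
next
  case False
  let ?f = "\<lambda>x. inner (A *v x) x" and ?K = "V \<inter> sphere 0 1"
  have unit: "x /\<^sub>R norm x \<in> ?K" if "x \<in> V" "x \<noteq> 0" for x
    using that V by (simp add: subspace_scale)
  have "compact ?K"
    using closed_subspace[OF V] by (simp add: closed_Int_compact)
  moreover have "?K \<noteq> {}" using unit[OF v False] by blast
  moreover have "continuous_on ?K ?f"
    by (intro continuous_intros)
  ultimately obtain u where u: "u \<in> ?K" and min: "\<And>x. x \<in> ?K \<Longrightarrow> ?f u \<le> ?f x"
    using continuous_attains_inf[of ?K ?f] by blast
  define c where "c = ?f u"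
  have ray: "c * (norm x)\<^sup>2 \<le> ?f x" if "x \<in> V" for x
  proof (cases "x = 0")
    case False
    have "c \<le> ?f (x /\<^sub>R norm x)" using min[OF unit[OF that False]] by (simp add: c_def)
    also have "\<dots> = ?f x / (norm x)\<^sup>2"
      by (simp add: matrix_vector_mult_scaleR power2_eq_square field_simps)
    finally show ?thesis using False by (simp add: field_simps)
  qed simp
  define T where "T x = A *v x - c *\<^sub>R x" for x
  have "linear T"
    unfolding T_def by (intro linearI) (simp_all add: matrix_vector_right_distrib
        matrix_vector_mult_scaleR algebra_simps)
  have Tu: "T u \<in> V" using u V inv by (simp add: T_def subspace_diff subspace_scale)
  have "(inner (T u) (T u))\<^sup>2 \<le> inner (T u) u * inner (T (T u)) (T u)"
  proof (rule psd_Cauchy_Schwarz[OF \<open>linear T\<close> V])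
    show "inner (T x) y = inner x (T y)" for x y
      unfolding T_def inner_diff_left inner_diff_right
      using sym by (simp, metis dot_lmul_matrix transpose_matrix_vector)
    show "0 \<le> inner (T x) x" if "x \<in> V" for x
      using ray[OF that] by (simp add: T_def inner_diff_left dot_square_norm)
  qed (use u Tu in auto)
  moreover have "inner (T u) u = 0"
    using u by (simp add: T_def inner_diff_left c_def dot_square_norm)
  ultimately have "T u = 0" by simp
  then have "A *v u = c *\<^sub>R u" by (simp add: T_def)
  moreover have "u \<in> V" "u \<noteq> 0" using u by auto
  ultimately have "c \<in> {c. \<exists>v\<in>V. v \<noteq> 0 \<and> A *v v = c *\<^sub>R v}" by blast
  then have "min_eigenvalue_on V A \<le> c"
    unfolding min_eigenvalue_on_def by (intro Min_le finite_eigenvalues_on sym)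
  then have "min_eigenvalue_on V A * (norm v)\<^sup>2 \<le> c * (norm v)\<^sup>2"
    by (rule mult_right_mono) simp
  also have "\<dots> \<le> ?f v" by (rule ray[OF v])
  finally show ?thesis .
qed

section \<open>The frame operator of a weighted family\<close>

text \<open>The inner product of the scalar field as a real vector space is the real part of
  \<open>x * rc_cnj y\<close>; compare the norms in \<open>(x + y) * rc_cnj (x + y)\<close>.\<close>

lemma inner_eq_inner_mult_rc_cnj: "inner x y = inner (x * rc_cnj y) (1::'f::real_or_complex)"
proof -
  have "(of_real ((norm (x + y))\<^sup>2) :: 'f) = (x + y) * rc_cnj (x + y)"
    by (simp only: rc_mult_cnj)
  also have "\<dots> = x * rc_cnj x + y * rc_cnj y + (x * rc_cnj y + rc_cnj (x * rc_cnj y))"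
    by (simp add: rc_cnj_add rc_cnj_mult algebra_simps)
  also have "\<dots> = of_real ((norm x)\<^sup>2 + (norm y)\<^sup>2 + 2 * inner (x * rc_cnj y) 1)"
    by (simp add: rc_mult_cnj rc_of_real_inner_1)
  finally have "(norm (x + y))\<^sup>2 = (norm x)\<^sup>2 + (norm y)\<^sup>2 + 2 * inner (x * rc_cnj y) 1"
    by (simp only: of_real_eq_iff)
  then show ?thesis using dot_norm[of x y] by simp
qed

lemma inner_rc_cnj: "inner (rc_cnj x) (rc_cnj y) = inner x (y::'f::real_or_complex)"
  by (metis inner_commute inner_eq_inner_mult_rc_cnj mult.commute rc_cnj_cnj)

lemma inner_eq_inner_hip: "inner x y = inner (hip x y) 1"
  by (simp add: inner_vec_def hip_def inner_sum_left inner_eq_inner_mult_rc_cnj[of "x $ _"])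

lemma inner_scale_left: "inner (c *s x) y = inner c (hip y x)"
  by (metis hip_commute hip_scale_left inner_eq_inner_hip inner_eq_inner_mult_rc_cnj)

lemma norm_hip_commute: "norm (hip x y) = norm (hip y x)"
  using inner_rc_cnj[of "hip x y" "hip x y"] by (simp add: hip_commute norm_eq_sqrt_inner)

lemma hip_add_left: "hip (x + z) y = hip x y + hip z y"
  by (simp add: hip_def sum.distrib algebra_simps)

lemma hip_sum: "hip (\<Sum>i\<in>A. f i) y = (\<Sum>i\<in>A. hip (f i) y)"
proof (induction A rule: infinite_finite_induct)
  case (insert i A)
  then show ?case by (simp add: hip_add_left)
qed (simp_all add: hip_def)

lemma scaleR_eq_of_real_scale: "r *\<^sub>R x = (of_real r :: 'f::real_or_complex) *s x"
  by (simp add: vec_eq_iff scaleR_conv_of_real[of r "x $ _"])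

lemma inner_hip_commute: "inner (hip x y) (hip x z) = inner (hip y x) (hip z x)"
  using inner_rc_cnj[of "hip x y" "hip x z"] by (simp add: hip_commute)

text \<open>The operator \<open>\<Sum>i. w i P\<^sub>i\<close>. A family indexed by a subset is encoded by weights that vanish
  outside of the subset.\<close>

definition frame_op :: "('k::finite \<Rightarrow> real) \<Rightarrow> ('k \<Rightarrow> 'f::real_or_complex^'n) \<Rightarrow> 'f^'n \<Rightarrow> 'f^'n"
  where "frame_op w \<phi> a = (\<Sum>i\<in>UNIV. (of_real (w i) * hip a (\<phi> i)) *s \<phi> i)"

lemma frame_op_add: "frame_op w \<phi> (a + b) = frame_op w \<phi> a + frame_op w \<phi> b"
  by (simp add: frame_op_def hip_add_left distrib_left vec.scale_left_distrib sum.distrib)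

lemma frame_op_scale: "frame_op w \<phi> (c *s a) = c *s frame_op w \<phi> a"
  by (simp add: frame_op_def hip_scale_left vec.scale_sum_right ac_simps)

lemma frame_op_scaleR: "frame_op w \<phi> (r *\<^sub>R a) = r *\<^sub>R frame_op w \<phi> a"
  by (simp add: scaleR_eq_of_real_scale frame_op_scale)

lemma inner_frame_op:
  "inner (frame_op w \<phi> a) b = (\<Sum>i\<in>UNIV. w i * inner (hip a (\<phi> i)) (hip b (\<phi> i)))"
  by (simp add: frame_op_def inner_sum_left inner_scale_left flip: scaleR_conv_of_real)

lemma inner_frame_op_self:
  "inner (frame_op w \<phi> a) a = (\<Sum>i\<in>UNIV. w i * (norm (hip a (\<phi> i)))\<^sup>2)"
  by (simp add: inner_frame_op dot_square_norm)

lemma inner_frame_op_sym: "inner (frame_op w \<phi> a) b = inner a (frame_op w \<phi> b)"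
  by (simp add: inner_frame_op inner_commute[of a])  (simp add: inner_commute)

lemma rc_cnj_of_real: "rc_cnj (of_real r :: 'f::real_or_complex) = of_real r"
  by (simp add: rc_cnj_eq rc_inner_1_1 of_real_def scaleR_left_diff_distrib[symmetric])

lemma hip_frame_op_sym: "hip (frame_op w \<phi> a) b = hip a (frame_op w \<phi> b)"
proof -
  have left: "hip (frame_op w \<phi> a) b = (\<Sum>i\<in>UNIV. of_real (w i) * hip a (\<phi> i) * hip (\<phi> i) b)" for a b
    by (simp add: frame_op_def hip_sum hip_scale_left)
  have "hip a (frame_op w \<phi> b) = rc_cnj (hip (frame_op w \<phi> b) a)" by (simp add: hip_commute)
  then show ?thesis
    by (simp add: left rc_cnj_sum rc_cnj_mult rc_cnj_of_real hip_commute ac_simps)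
qed

lemma frame_op_in_subspace:
  assumes "vec.subspace H" and "\<And>i. \<phi> i \<in> H"
  shows "frame_op w \<phi> a \<in> H"
  unfolding frame_op_def using assms by (intro vec.subspace_sum vec.subspace_scale)

lemma subspace_of_vec_subspace:
  fixes H :: "('f::real_or_complex^'n) set"
  assumes "vec.subspace H"
  shows "subspace H"
  unfolding subspace_def using assms
  by (simp add: scaleR_eq_of_real_scale vec.subspace_0 vec.subspace_add vec.subspace_scale)

text \<open>The spectrum of an operator between \<open>1 - \<epsilon>\<close> and \<open>1 + \<epsilon>\<close> satisfies
  \<open>(t - (1 - \<epsilon>)) ((1 + \<epsilon>) - t) \<ge> 0\<close>; the following is the resulting operator inequality.\<close>

lemma norm_frame_op_sq_le:
  fixes H :: "('f::real_or_complex^'n) set"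
  assumes H: "vec.subspace H" and \<phi>: "\<And>i. \<phi> i \<in> H"
    and lb: "\<And>a. a \<in> H \<Longrightarrow> (1 - \<epsilon>) * (norm a)\<^sup>2 \<le> inner (frame_op w \<phi> a) a"
    and ub: "\<And>a. a \<in> H \<Longrightarrow> inner (frame_op w \<phi> a) a \<le> (1 + \<epsilon>) * (norm a)\<^sup>2"
    and a: "a \<in> H"
  shows "(norm (frame_op w \<phi> a))\<^sup>2
    \<le> 2 * inner (frame_op w \<phi> a) a - (1 - \<epsilon>\<^sup>2) * (norm a)\<^sup>2"
proof -
  define T where "T x = frame_op w \<phi> x - (1 - \<epsilon>) *\<^sub>R x" for x
  note V = subspace_of_vec_subspace[OF H]
  have form: "inner (T x) x = inner (frame_op w \<phi> x) x - (1 - \<epsilon>) * (norm x)\<^sup>2" for x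
    by (simp add: T_def inner_diff_left dot_square_norm)
  have "(norm (T a))\<^sup>2 \<le> 2 * \<epsilon> * inner (T a) a"
  proof (rule psd_norm_sq_le[OF _ V])
    show "linear T"
    proof (rule linearI)
      show "T (x + y) = T x + T y" for x y
        by (simp add: T_def frame_op_add scaleR_right_distrib)
      show "T (r *\<^sub>R x) = r *\<^sub>R T x" for r x
        by (simp add: T_def frame_op_scaleR scaleR_diff_right mult.commute)
    qed
    show "T x \<in> H" if "x \<in> H" for x
      unfolding T_def using that V H \<phi> by (intro subspace_diff subspace_scale frame_op_in_subspace)
    show "inner (T x) y = inner x (T y)" for x y
      by (simp add: T_def inner_diff_left inner_diff_right inner_frame_op_sym)
    show "0 \<le> inner (T x) x" if "x \<in> H" for x using lb[OF that] by (simp add: form)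
    show "inner (T x) x \<le> 2 * \<epsilon> * (norm x)\<^sup>2" if "x \<in> H" for x
      using ub[OF that] by (simp add: form algebra_simps)
  qed (rule a)
  moreover have "(norm (T a))\<^sup>2 = (norm (frame_op w \<phi> a))\<^sup>2
      - 2 * (1 - \<epsilon>) * inner (frame_op w \<phi> a) a + (1 - \<epsilon>)\<^sup>2 * (norm a)\<^sup>2"
    unfolding T_def dot_square_norm[symmetric]
    by (simp add: inner_diff_left inner_diff_right inner_commute power2_eq_square algebra_simps)
  ultimately show ?thesis unfolding form by (simp add: power2_eq_square algebra_simps)
qed

text \<open>A weighted family with a positive lower frame bound spans: its frame operator is injective
  and has its range in the span of the vectors of nonzero weight.\<close>

lemma dim_le_card_of_lower_bound:
  fixes H :: "('f::real_or_complex^'n) set"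
  assumes H: "vec.subspace H" and c: "c > 0"
    and lb: "\<And>a. a \<in> H \<Longrightarrow> c * (norm a)\<^sup>2 \<le> inner (frame_op w \<phi> a) a"
    and w: "\<And>i. i \<notin> J \<Longrightarrow> w i = 0"
  shows "vec.dim H \<le> card J"
proof -
  let ?S = "frame_op w \<phi>"
  have lin: "Vector_Spaces.linear (*s) (*s) ?S"
    by unfold_locales (simp_all add: frame_op_add frame_op_scale)
  have zero: "a = 0" if "a \<in> H" "?S a = 0" for a
  proof -
    have "c * (norm a)\<^sup>2 \<le> 0" using lb[OF that(1)] that(2) by simp
    then show ?thesis using c by (simp add: mult_le_0_iff)
  qed
  have span: "vec.span H = H" using H by (simp add: vec.span_eq_iff)
  have "inj_on ?S (vec.span H)"
    using vec.linear_inj_on_iff_eq_0[OF lin H] zero unfolding span by blast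
  then have "vec.dim H = vec.dim (?S ` H)" using vec.dim_image_eq[OF lin] by metis
  also have "\<dots> \<le> card (\<phi> ` J)"
  proof (rule vec.dim_le_card)
    show "?S ` H \<subseteq> vec.span (\<phi> ` J)"
    proof safe
      fix a
      show "?S a \<in> vec.span (\<phi> ` J)" unfolding frame_op_def
      proof (intro vec.span_sum)
        fix i
        show "(of_real (w i) * hip a (\<phi> i)) *s \<phi> i \<in> vec.span (\<phi> ` J)"
          by (cases "i \<in> J") (simp_all add: w vec.span_base vec.span_scale vec.span_zero)
      qed
    qed
  qed simp
  also have "\<dots> \<le> card J" by (simp add: card_image_le)
  finally show ?thesis .
qed

section \<open>Unit-norm tight frames\<close>

lemma untf_dim_pos:
  fixes H :: "('f::real_or_complex^'n) set"
  assumes "unit_norm_tight_frame H \<phi>"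
  shows "vec.dim H > 0"
proof (rule ccontr)
  assume "\<not> vec.dim H > 0"
  then have "H \<subseteq> {0}" by (simp add: vec.dim_eq_0)
  moreover have "\<phi> i \<in> H" "norm (\<phi> i) = 1" for i
    using assms by (simp_all add: unit_norm_tight_frame_def)
  ultimately show False by (metis empty_iff insert_iff norm_zero subsetD zero_neq_one)
qed

text \<open>Real polarization of the tight frame identity.\<close>

lemma untf_polarization:
  fixes H :: "('f::real_or_complex^'n) set" and \<phi> :: "'k::finite \<Rightarrow> 'f^'n"
  assumes H: "vec.subspace H" and \<phi>: "unit_norm_tight_frame H \<phi>" and a: "a \<in> H" and b: "b \<in> H"
  shows "(\<Sum>k\<in>UNIV. inner (hip a (\<phi> k)) (hip b (\<phi> k)))
    = real CARD('k) / real (vec.dim H) * inner a b"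
proof -
  let ?r = "real CARD('k) / real (vec.dim H)"
  have Q: "(\<Sum>k\<in>UNIV. (norm (hip x (\<phi> k)))\<^sup>2) = ?r * (norm x)\<^sup>2" if "x \<in> H" for x
    using \<phi> that by (simp add: unit_norm_tight_frame_def)
  have "(\<Sum>k\<in>UNIV. inner (hip a (\<phi> k)) (hip b (\<phi> k)))
      = (\<Sum>k\<in>UNIV. ((norm (hip (a + b) (\<phi> k)))\<^sup>2 - (norm (hip a (\<phi> k)))\<^sup>2
          - (norm (hip b (\<phi> k)))\<^sup>2) / 2)"
    by (simp add: dot_norm hip_add_left)
  also have "\<dots> = (?r * (norm (a + b))\<^sup>2 - ?r * (norm a)\<^sup>2 - ?r * (norm b)\<^sup>2) / 2"
    using Q[OF vec.subspace_add[OF H a b]] Q[OF a] Q[OF b]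
    by (simp only: sum_divide_distrib[symmetric] sum_subtractf)
  also have "\<dots> = ?r * inner a b"
    by (simp add: dot_norm right_diff_distrib)
  finally show ?thesis .
qed

text \<open>Summing a quadratic form over the vectors of the frame gives \<open>N / m\<close> times its trace. Hence
  the right-hand side below, divided by \<open>N / m\<close>, is the trace of the square of the frame operator.\<close>

lemma untf_sum_norm_frame_op_sq:
  fixes H :: "('f::real_or_complex^'n) set" and \<phi> :: "'k::finite \<Rightarrow> 'f^'n"
  assumes H: "vec.subspace H" and \<phi>: "unit_norm_tight_frame H \<phi>"
  shows "(\<Sum>k\<in>UNIV. (norm (frame_op w \<phi> (\<phi> k)))\<^sup>2)
    = real CARD('k) / real (vec.dim H)
      * (\<Sum>i\<in>UNIV. \<Sum>j\<in>UNIV. w i * w j * (norm (hip (\<phi> i) (\<phi> j)))\<^sup>2)"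
proof -
  let ?S = "frame_op w \<phi>" and ?r = "real CARD('k) / real (vec.dim H)"
  have in_H: "\<phi> i \<in> H" for i using \<phi> by (simp add: unit_norm_tight_frame_def)
  have "(\<Sum>k\<in>UNIV. (norm (?S (\<phi> k)))\<^sup>2)
      = (\<Sum>k\<in>UNIV. \<Sum>i\<in>UNIV. w i * inner (hip (\<phi> i) (\<phi> k)) (hip (?S (\<phi> i)) (\<phi> k)))"
  proof (rule sum.cong[OF refl])
    fix k
    have "(norm (?S (\<phi> k)))\<^sup>2 = inner (?S (\<phi> k)) (?S (\<phi> k))" by (simp add: dot_square_norm)
    also have "\<dots> = (\<Sum>i\<in>UNIV. w i * inner (hip (\<phi> k) (\<phi> i)) (hip (\<phi> k) (?S (\<phi> i))))"
      by (simp add: inner_frame_op hip_frame_op_sym)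
    also have "\<dots> = (\<Sum>i\<in>UNIV. w i * inner (hip (\<phi> i) (\<phi> k)) (hip (?S (\<phi> i)) (\<phi> k)))"
      by (intro sum.cong refl arg_cong2[where f = "(*)"] inner_hip_commute)
    finally show "(norm (?S (\<phi> k)))\<^sup>2
      = (\<Sum>i\<in>UNIV. w i * inner (hip (\<phi> i) (\<phi> k)) (hip (?S (\<phi> i)) (\<phi> k)))" .
  qed
  also have "\<dots> = (\<Sum>i\<in>UNIV. w i * (\<Sum>k\<in>UNIV. inner (hip (\<phi> i) (\<phi> k)) (hip (?S (\<phi> i)) (\<phi> k))))"
    by (subst sum.swap) (simp add: sum_distrib_left)
  also have "\<dots> = (\<Sum>i\<in>UNIV. w i * (?r * inner (?S (\<phi> i)) (\<phi> i)))"
    by (simp add: untf_polarization[OF H \<phi> in_H frame_op_in_subspace[OF H in_H]] inner_commute)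
  also have "\<dots> = ?r * (\<Sum>i\<in>UNIV. \<Sum>j\<in>UNIV. w i * w j * (norm (hip (\<phi> i) (\<phi> j)))\<^sup>2)"
    by (simp add: inner_frame_op_self sum_distrib_left ac_simps)
  finally show ?thesis .
qed

lemma gram_matrix_eq:
  fixes H :: "('f::real_or_complex^'n) set" and \<phi> :: "'k::finite \<Rightarrow> 'f^'n"
  assumes "vec.subspace H" and "unit_norm_tight_frame H \<phi>"
  shows "gram_matrix H \<phi> $ i $ j = (norm (hip (\<phi> i) (\<phi> j)))\<^sup>2 - 1 / real (vec.dim H)"
  using of_real_gram_matrix[OF assms, of i j]
  by (simp only: trace_Q_comp_Q[OF assms] of_real_eq_iff)

lemma gram_matrix_form:
  fixes H :: "('f::real_or_complex^'n) set" and \<phi> :: "'k::finite \<Rightarrow> 'f^'n"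
  assumes "vec.subspace H" and "unit_norm_tight_frame H \<phi>"
  shows "inner (gram_matrix H \<phi> *v x) x
    = (\<Sum>i\<in>UNIV. \<Sum>j\<in>UNIV. x $ i * x $ j * (norm (hip (\<phi> i) (\<phi> j)))\<^sup>2)
      - (\<Sum>i\<in>UNIV. x $ i)\<^sup>2 / real (vec.dim H)"
proof -
  let ?h = "\<lambda>i j. (norm (hip (\<phi> i) (\<phi> j)))\<^sup>2" and ?m = "real (vec.dim H)"
  have "inner (gram_matrix H \<phi> *v x) x
      = (\<Sum>i\<in>UNIV. \<Sum>j\<in>UNIV. gram_matrix H \<phi> $ i $ j * x $ j * x $ i)"
    by (simp add: inner_vec_def matrix_vector_mult_def sum_distrib_right)
  also have "\<dots> = (\<Sum>i\<in>UNIV. \<Sum>j\<in>UNIV. x $ i * x $ j * ?h i j - x $ i * x $ j / ?m)"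
    unfolding gram_matrix_eq[OF assms] by (intro sum.cong refl) (simp add: algebra_simps)
  also have "\<dots> = (\<Sum>i\<in>UNIV. \<Sum>j\<in>UNIV. x $ i * x $ j * ?h i j)
      - (\<Sum>i\<in>UNIV. \<Sum>j\<in>UNIV. x $ i * x $ j) / ?m"
    by (simp only: sum_subtractf sum_divide_distrib)
  also have "(\<Sum>i\<in>UNIV. \<Sum>j\<in>UNIV. x $ i * x $ j) = (\<Sum>i\<in>UNIV. x $ i)\<^sup>2"
    by (simp only: power2_eq_square sum_product)
  finally show ?thesis .
qed

text \<open>The Rayleigh bound at the component of \<open>x\<close> orthogonal to the all-ones vector. Dropping the
  other component does not change the form, since tightness puts the all-ones vector in the kernel
  of the Gram matrix.\<close>

lemma frame_gamma_le:
  fixes H :: "('f::real_or_complex^'n) set" and \<phi> :: "'k::finite \<Rightarrow> 'f^'n"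
  assumes H: "vec.subspace H" and \<phi>: "unit_norm_tight_frame H \<phi>"
  shows "frame_gamma H \<phi> * ((norm x)\<^sup>2 - (\<Sum>i\<in>UNIV. x $ i)\<^sup>2 / real CARD('k))
    \<le> inner (gram_matrix H \<phi> *v x) x"
proof -
  let ?G = "gram_matrix H \<phi>" and ?N = "real CARD('k)"
  have sym: "transpose ?G = ?G"
    by (simp add: vec_eq_iff transpose_def gram_matrix_eq[OF assms] norm_hip_commute)
  have G_sym: "inner (?G *v x) y = inner x (?G *v y)" for x y
    using sym by (metis dot_lmul_matrix transpose_matrix_vector)
  have G_one: "?G *v 1 = 0"
  proof -
    have "(\<Sum>j\<in>UNIV. (norm (hip (\<phi> i) (\<phi> j)))\<^sup>2) = ?N / real (vec.dim H)" for i
      using \<phi> by (simp add: unit_norm_tight_frame_def)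
    then show ?thesis
      by (simp add: vec_eq_iff matrix_vector_mult_def gram_matrix_eq[OF assms] sum_subtractf)
  qed
  have one: "inner x 1 = (\<Sum>i\<in>UNIV. x $ i)" for x :: "real^'k"
    by (simp add: inner_vec_def)
  define t where "t = (\<Sum>i\<in>UNIV. x $ i) / ?N"
  define y where "y = x - t *\<^sub>R 1"
  have N: "inner (1::real^'k) 1 = ?N" by (simp add: one)
  have y1: "inner y 1 = 0"
    by (simp only: y_def inner_diff_left inner_scaleR_left N) (simp add: one t_def)
  have "frame_gamma H \<phi> * (norm y)\<^sup>2 \<le> inner (?G *v y) y"
    unfolding frame_gamma_def
  proof (rule min_eigenvalue_on_le[OF sym])
    show "subspace ({1}\<^sup>\<bottom> :: (real^'k) set)" by (rule subspace_orthogonal_comp)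
    show "?G *v z \<in> {1}\<^sup>\<bottom>" for z
      by (simp add: orthogonal_comp_def orthogonal_def G_sym[symmetric] G_one)
    show "y \<in> {1}\<^sup>\<bottom>" using y1 by (simp add: orthogonal_comp_def orthogonal_def inner_commute)
  qed
  moreover have "inner (?G *v y) y = inner (?G *v x) x"
  proof -
    have "?G *v y = ?G *v x"
      by (simp add: y_def matrix_vector_mult_diff_distrib matrix_vector_mult_scaleR G_one)
    then show ?thesis
      by (simp add: y_def inner_diff_right G_sym[of x 1] G_one)
  qed
  moreover have "(norm y)\<^sup>2 = (norm x)\<^sup>2 - (\<Sum>i\<in>UNIV. x $ i)\<^sup>2 / ?N"
  proof -
    have "(norm y)\<^sup>2 = inner y x"
      using y1 by (simp add: dot_square_norm[symmetric] y_def inner_diff_right)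
    also have "\<dots> = (norm x)\<^sup>2 - t * (\<Sum>i\<in>UNIV. x $ i)"
      by (simp add: y_def inner_diff_left dot_square_norm one inner_commute[of 1])
    finally show ?thesis by (simp add: t_def power2_eq_square)
  qed
  ultimately show ?thesis by simp
qed

section \<open>The lower bound on the number of vectors\<close>

text \<open>The final rearrangement, with \<open>J\<close> for the number of vectors and \<open>g\<close> for \<open>\<gamma>\<close>.\<close>

lemma card_bound_of_gap:
  fixes W J N m g \<epsilon> :: real
  assumes W: "W > 0" and J: "J > 0" and N: "N > 0" and m: "m > 0" and g: "g > 0"
    and D: "1 - \<epsilon>\<^sup>2 > 0"
    and gap: "g * (W\<^sup>2 / J - W\<^sup>2 / N) \<le> W\<^sup>2 / (m * (1 - \<epsilon>\<^sup>2)) - W\<^sup>2 / m"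
  shows "m * g * N * (1 - \<epsilon>\<^sup>2) / (m * g * (1 - \<epsilon>\<^sup>2) + N * \<epsilon>\<^sup>2) \<le> J"
proof -
  let ?D = "1 - \<epsilon>\<^sup>2"
  let ?C = "J * N * (m * ?D)"
  have "W\<^sup>2 * (g * (1 / J - 1 / N)) \<le> W\<^sup>2 * (1 / (m * ?D) - 1 / m)"
    using gap by (simp add: right_diff_distrib mult.commute mult.left_commute)
  then have "g * (1 / J - 1 / N) \<le> 1 / (m * ?D) - 1 / m"
    by (rule mult_left_le_imp_le) (use W in simp)
  also have "1 / (m * ?D) - 1 / m = \<epsilon>\<^sup>2 / (m * ?D)"
    using D m by (simp add: divide_simps)
  finally have "?C * (g * (1 / J - 1 / N)) \<le> ?C * (\<epsilon>\<^sup>2 / (m * ?D))"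
    using J N D m by (intro mult_left_mono) simp_all
  moreover have "?C * (g * (1 / J - 1 / N)) = g * (m * ?D) * (N - J)"
    using J N by (simp add: field_simps)
  moreover have "?C * (\<epsilon>\<^sup>2 / (m * ?D)) = J * N * \<epsilon>\<^sup>2"
    using D m by simp
  ultimately have "m * g * N * ?D \<le> J * (m * g * ?D + N * \<epsilon>\<^sup>2)"
    by (simp add: algebra_simps)
  moreover have "m * g * ?D + N * \<epsilon>\<^sup>2 > 0"
    using g m D N by (intro add_pos_nonneg mult_pos_pos) simp_all
  ultimately show ?thesis by (simp add: divide_le_eq)
qed

theorem theorem2p4:
  fixes H :: "('f::real_or_complex^'n) set"
    and \<phi> :: "'k::finite \<Rightarrow> 'f^'n"
    and J :: "'k set"
    and w :: "'k \<Rightarrow> real"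
    and \<epsilon> :: real
    and m N :: nat
  assumes "vec.subspace H"
    and "vec.dim H = m"
    and "CARD('k) = N"
    and "N \<ge> 2"
    and "unit_norm_tight_frame H \<phi>"
    and "frame_gamma H \<phi> > 0"
    and "\<And>i. i \<in> J \<Longrightarrow> w i > 0"
    and "0 \<le> \<epsilon>"
    and "\<epsilon> < 1"
    and "\<And>a. a \<in> H \<Longrightarrow> (1 - \<epsilon>) * (norm a)\<^sup>2 \<le> (\<Sum>i\<in>J. w i * (norm (hip a (\<phi> i)))\<^sup>2)"
    and "\<And>a. a \<in> H \<Longrightarrow> (\<Sum>i\<in>J. w i * (norm (hip a (\<phi> i)))\<^sup>2) \<le> (1 + \<epsilon>) * (norm a)\<^sup>2"
  shows "real (card J) \<ge> max (real m)
     (real m * frame_gamma H \<phi> * real N * (1 - \<epsilon>\<^sup>2)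
        / (real m * frame_gamma H \<phi> * (1 - \<epsilon>\<^sup>2) + real N * \<epsilon>\<^sup>2))"
proof -
  note H = assms(1) and \<phi> = assms(5) and eps = assms(8,9)
  have m: "vec.dim H = m" and N: "CARD('k) = N" by fact+
  have in_H: "\<phi> i \<in> H" and nrm: "norm (\<phi> i) = 1" for i
    using \<phi> by (auto simp: unit_norm_tight_frame_def)
  define v where "v i = (if i \<in> J then w i else 0)" for i
  define W where "W = (\<Sum>i\<in>J. w i)"
  define q where "q = (\<Sum>i\<in>UNIV. \<Sum>j\<in>UNIV. v i * v j * (norm (hip (\<phi> i) (\<phi> j)))\<^sup>2)"
  define D where "D = 1 - \<epsilon>\<^sup>2"
  let ?\<gamma> = "frame_gamma H \<phi>" and ?S = "frame_op v \<phi>"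
  have v_sum: "(\<Sum>i\<in>UNIV. v i * f i) = (\<Sum>i\<in>J. w i * f i)" for f :: "'k \<Rightarrow> real"
    by (rule sum.mono_neutral_cong_right) (auto simp: v_def)
  have form: "inner (?S a) a = (\<Sum>i\<in>J. w i * (norm (hip a (\<phi> i)))\<^sup>2)" for a
    by (simp add: inner_frame_op_self v_sum)
  have D: "D > 0" using eps by (simp add: D_def power_less_one_iff abs_square_less_1)
  have m0: "m > 0" using untf_dim_pos[OF \<phi>] m by simp
  have N0: "N > 0" using assms(4) by simp
  have "vec.dim H \<le> card J"
    by (rule dim_le_card_of_lower_bound[OF H, of "1 - \<epsilon>" v \<phi>])
      (use eps assms(10) in \<open>auto simp: form v_def\<close>)
  then have card: "m \<le> card J" by (simp add: m)
  then have "J \<noteq> {}" using m0 by auto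
  then have W: "W > 0" unfolding W_def using assms(7) by (intro sum_pos) auto

  \<comment> \<open>\<open>q\<close> is the trace of \<open>S\<^sup>2\<close>; sum the operator inequality over the vectors of the frame\<close>
  have q_le: "q \<le> 2 * W - real m * D"
  proof -
    have "real N / real m * q = (\<Sum>k\<in>UNIV. (norm (?S (\<phi> k)))\<^sup>2)"
      using untf_sum_norm_frame_op_sq[OF H \<phi>, of v] by (simp add: q_def m N)
    also have "\<dots> \<le> (\<Sum>k\<in>UNIV. 2 * inner (?S (\<phi> k)) (\<phi> k) - D * (norm (\<phi> k))\<^sup>2)"
      unfolding D_def
      by (intro sum_mono norm_frame_op_sq_le[OF H in_H]) (use assms(10,11) in_H in \<open>auto simp: form\<close>)
    also have "\<dots> = 2 * (\<Sum>k\<in>UNIV. inner (?S (\<phi> k)) (\<phi> k)) - real N * D"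
      by (simp add: nrm sum_subtractf sum_distrib_left N)
    also have "(\<Sum>k\<in>UNIV. inner (?S (\<phi> k)) (\<phi> k))
        = (\<Sum>i\<in>J. w i * (\<Sum>k\<in>UNIV. (norm (hip (\<phi> i) (\<phi> k)))\<^sup>2))"
      unfolding form sum_distrib_left
      by (subst sum.swap) (intro sum.cong refl arg_cong2[where f = "(*)"] arg_cong2[where f = power]
          norm_hip_commute)
    also have "\<dots> = (\<Sum>i\<in>J. w i * (real N / real m))"
      using \<phi> in_H by (simp add: unit_norm_tight_frame_def nrm m N)
    also have "\<dots> = real N / real m * W"
      unfolding W_def sum_distrib_right[symmetric] by (rule mult.commute)
    finally have "real N / real m * q \<le> real N / real m * (2 * W - real m * D)"
      using m0 by (simp add: algebra_simps)
    then show ?thesis by (rule mult_left_le_imp_le) (simp add: m0 N0)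
  qed

  have v_sq: "(norm (\<chi> i. v i))\<^sup>2 = (\<Sum>i\<in>J. (w i)\<^sup>2)"
  proof -
    have "(norm (\<chi> i. v i))\<^sup>2 = (\<Sum>i\<in>UNIV. v i * v i)"
      by (simp add: dot_square_norm[symmetric] inner_vec_def)
    also have "\<dots> = (\<Sum>i\<in>J. w i * v i)" by (rule v_sum)
    also have "\<dots> = (\<Sum>i\<in>J. (w i)\<^sup>2)" by (simp add: v_def power2_eq_square)
    finally show ?thesis .
  qed
  have v_W: "(\<Sum>i\<in>UNIV. v i) = W" using v_sum[of "\<lambda>_. 1"] by (simp add: W_def)
  have "?\<gamma> * ((\<Sum>i\<in>J. (w i)\<^sup>2) - W\<^sup>2 / real N) \<le> q - W\<^sup>2 / real m"
    using frame_gamma_le[OF H \<phi>, of "\<chi> i. v i"]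
    by (simp add: gram_matrix_form[OF H \<phi>] v_sq v_W q_def m N)
  moreover have "W\<^sup>2 / real (card J) \<le> (\<Sum>i\<in>J. (w i)\<^sup>2)"
    using sum_squared_le_sum_of_squares[of w J] \<open>J \<noteq> {}\<close> card m0
    by (simp add: W_def divide_le_eq card_gt_0_iff)
  then have "?\<gamma> * (W\<^sup>2 / real (card J) - W\<^sup>2 / real N) \<le> ?\<gamma> * ((\<Sum>i\<in>J. (w i)\<^sup>2) - W\<^sup>2 / real N)"
    using assms(6) by simp
  \<comment> \<open>this removes the dependence on the unknown total weight \<open>W\<close>: the worst case is \<open>W = m D\<close>\<close>
  moreover have "q \<le> W\<^sup>2 / (real m * D)"
  proof -
    have "0 \<le> (W - real m * D)\<^sup>2" by simp
    then have "(2 * W - real m * D) * (real m * D) \<le> W\<^sup>2"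
      by (simp add: power2_eq_square algebra_simps)
    then have "2 * W - real m * D \<le> W\<^sup>2 / (real m * D)"
      using D m0 by (simp add: le_divide_eq)
    then show ?thesis using q_le by simp
  qed
  ultimately have "?\<gamma> * (W\<^sup>2 / real (card J) - W\<^sup>2 / real N) \<le> W\<^sup>2 / (real m * D) - W\<^sup>2 / real m"
    by linarith
  then have "real m * ?\<gamma> * real N * D / (real m * ?\<gamma> * D + real N * \<epsilon>\<^sup>2) \<le> real (card J)"
    using card_bound_of_gap[of W "real (card J)" "real N" "real m" ?\<gamma> \<epsilon>] W card m0 N0 assms(6) D
    by (simp add: D_def)
  then show ?thesis using card by (simp add: D_def)
qed

end
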